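(* Let $\mathcal{A}=(\omega,E)$ be a computably enumerable equivalence structure with no infinite equivalence classes and an unbounded character. Then there is a computable $s_1$-function $f$ such that $\mathcal{A}$ contains an equivalence class of size $m_i$ for all $i$, where $m_i=\lim_{s\to\infty} f(i,s)$.
   Context: A computably enumerable equivalence structure $(\omega,E)$ is $\omega$ with a computably enumerable equivalence relation $E$. It has unbounded character if there are arbitrarily large finite $k$ such that it has an equivalence class of size $k$. A function $f:\omega^2\to\omega$ is an $s_1$-function if (1) $f(i,s)\le f(i,s+1)$ for all $i,s$; (2) for every $i$ the limit $m_i=\lim_{s\to\infty}f(i,s)$ exists (is finite); (3) $m_i<m_{i+1}$ for every $i$. *)

theory Defs
  imports Complex_Main
begin

section \<open>Partial recursive functions\<close>

text \<open>
  Programs for the (Kleene) partial recursive functions.  Programs carry no arity; the arity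
  is the length of the argument list they are run on.
\<close>

datatype recf =
    Zero
  | Succ
  | Proj nat
  | Comp recf "recf list"
  | PrimRec recf recf
  | Mu recf

text \<open>
  \<open>evals r xs y\<close>: the program \<open>r\<close> halts on the arguments \<open>xs\<close> with output \<open>y\<close>.
  Recursion and minimisation act on the first argument; the step function of a primitive
  recursion receives the counter, then the previous value, then the parameters.
  In the last rule all values below the least zero must be defined and nonzero.
\<close>

inductive evals :: "recf \<Rightarrow> nat list \<Rightarrow> nat \<Rightarrow> bool" where
  evals_Zero: "evals Zero xs 0"
| evals_Succ: "evals Succ [x] (Suc x)"
| evals_Proj: "i < length xs \<Longrightarrow> evals (Proj i) xs (xs ! i)"
| evals_Comp:
    "list_all2 (\<lambda>g y. evals g xs y) gs ys \<Longrightarrow> evals f ys z \<Longrightarrow> evals (Comp f gs) xs z"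
| evals_PrimRec_0: "evals f xs y \<Longrightarrow> evals (PrimRec f g) (0 # xs) y"
| evals_PrimRec_Suc:
    "evals (PrimRec f g) (n # xs) y \<Longrightarrow> evals g (n # y # xs) z
      \<Longrightarrow> evals (PrimRec f g) (Suc n # xs) z"
| evals_Mu:
    "evals f (n # xs) 0 \<Longrightarrow> (\<forall>m<n. \<exists>y. evals f (m # xs) (Suc y)) \<Longrightarrow> evals (Mu f) xs n"

inductive_cases evals_ZeroE: "evals Zero xs z"
inductive_cases evals_SuccE: "evals Succ xs z"
inductive_cases evals_ProjE: "evals (Proj i) xs z"
inductive_cases evals_CompE: "evals (Comp f gs) xs z"
inductive_cases evals_PrimRec_0E: "evals (PrimRec f g) (0 # xs) z"
inductive_cases evals_PrimRec_SucE: "evals (PrimRec f g) (Suc n # xs) z"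
inductive_cases evals_MuE: "evals (Mu f) xs z"

lemma evals_deterministic: "evals r xs y \<Longrightarrow> evals r xs z \<Longrightarrow> z = y"
proof (induction arbitrary: z rule: evals.induct)
  case (evals_Zero xs)
  then show ?case by (auto elim: evals_ZeroE)
next
  case (evals_Succ x)
  then show ?case by (auto elim: evals_SuccE)
next
  case (evals_Proj i xs)
  then show ?case by (auto elim: evals_ProjE)
next
  case (evals_Comp xs gs ys f y)
  from evals_Comp.prems obtain ys' where
    ys': "list_all2 (\<lambda>g y. evals g xs y) gs ys'" "evals f ys' z"
    by (auto elim: evals_CompE)
  have "ys' = ys"
  proof (rule nth_equalityI)
    show len: "length ys' = length ys"
      using list_all2_lengthD[OF evals_Comp.IH(1)] list_all2_lengthD[OF ys'(1)] by simp
    fix i assume "i < length ys'"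
    then show "ys' ! i = ys ! i"
      using list_all2_nthD2[OF evals_Comp.IH(1), of i] list_all2_nthD2[OF ys'(1), of i] len
      by simp
  qed
  with ys'(2) have "evals f ys z" by simp
  then show ?case by (rule evals_Comp.IH(2))
next
  case (evals_PrimRec_0 f xs y g)
  then show ?case by (blast elim: evals_PrimRec_0E)
next
  case (evals_PrimRec_Suc f g n xs y y')
  from evals_PrimRec_Suc.prems obtain v where
    v: "evals (PrimRec f g) (n # xs) v" "evals g (n # v # xs) z"
    by (rule evals_PrimRec_SucE)
  have "v = y" using v(1) by (rule evals_PrimRec_Suc.IH(1))
  with v(2) have "evals g (n # y # xs) z" by blast
  then show ?case by (rule evals_PrimRec_Suc.IH(2))
next
  case (evals_Mu f n xs)
  from evals_Mu.prems have
    k: "evals f (z # xs) 0" "\<forall>m<z. \<exists>y. evals f (m # xs) (Suc y)"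
    by (auto elim: evals_MuE)
  show ?case
  proof (rule linorder_cases[of z n])
    assume "z < n"
    then obtain y where "\<forall>w. evals f (z # xs) w \<longrightarrow> w = Suc y"
      using evals_Mu.IH(2) by blast
    with k(1) have "0 = Suc y" by blast
    then show ?thesis by simp
  next
    assume "n < z"
    with k(2) obtain y where "evals f (n # xs) (Suc y)" by blast
    then have "Suc y = 0" by (rule evals_Mu.IH(1))
    then show ?thesis by simp
  qed
qed

definition computable1 :: "(nat \<Rightarrow> nat) \<Rightarrow> bool" where
  "computable1 g \<longleftrightarrow> (\<exists>r. \<forall>x. evals r [x] (g x))"

definition computable2 :: "(nat \<Rightarrow> nat \<Rightarrow> nat) \<Rightarrow> bool" where
  "computable2 f \<longleftrightarrow> (\<exists>r. \<forall>x y. evals r [x, y] (f x y))"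

text \<open>
  A binary relation is computably enumerable if it is empty or the range of a total computable
  function from \<open>\<omega>\<close> to \<open>\<omega>\<^sup>2\<close>; such a function is given by its two computable components.
\<close>

definition comp_enum_rel :: "(nat \<times> nat) set \<Rightarrow> bool" where
  "comp_enum_rel R \<longleftrightarrow>
    R = {} \<or> (\<exists>g h. computable1 g \<and> computable1 h \<and> R = range (\<lambda>n. (g n, h n)))"


section \<open>Equivalence structures\<close>

definition ce_equivalence_structure :: "(nat \<times> nat) set \<Rightarrow> bool" where
  "ce_equivalence_structure E \<longleftrightarrow> equiv UNIV E \<and> comp_enum_rel E"

definition has_class_of_size :: "(nat \<times> nat) set \<Rightarrow> nat \<Rightarrow> bool" where
  "has_class_of_size E k \<longleftrightarrow> (\<exists>C \<in> UNIV // E. finite C \<and> card C = k)"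

definition unbounded_character :: "(nat \<times> nat) set \<Rightarrow> bool" where
  "unbounded_character E \<longleftrightarrow> (\<forall>n. \<exists>k\<ge>n. has_class_of_size E k)"

text \<open>The limits are taken in the discrete topology of \<open>nat\<close>.\<close>

definition s1_function :: "(nat \<Rightarrow> nat \<Rightarrow> nat) \<Rightarrow> bool" where
  "s1_function f \<longleftrightarrow>
    (\<forall>i s. f i s \<le> f i (Suc s)) \<and>
    (\<forall>i. convergent (\<lambda>s. f i s)) \<and>
    (\<forall>i. lim (\<lambda>s. f i s) < lim (\<lambda>s. f (Suc i) s))"

end

theory Submission
  imports Defs
begin

text \<open>
  Enumerating \<open>E\<close> for \<open>s\<close> steps shows finitely many members of the class of \<open>x\<close>; their number
  \<open>c x s\<close> is computable, grows with \<open>s\<close>, and reaches the size of the class because the class is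
  finite.  So every class size is a limit from below of a computable sequence, but
  one cannot tell when the limit is reached.  The danger is that a class which was picked to be the
  \<open>(i+1)\<close>-st one is later overtaken by the \<open>i\<close>-th one; replacing it at that moment by another
  class must neither decrease the current value nor happen infinitely often.

  Maxima solve both problems.  For a fixed \<open>b\<close>, the maximum of \<open>c x s\<close> over \<open>x \<le> b\<close> grows with
  \<open>b\<close> and with \<open>s\<close>, and its limit in \<open>s\<close> is the largest of finitely many class sizes, hence
  again a class size.  Since the character is unbounded, an unbounded search finds, for each \<open>m\<close>,
  some \<open>bound m\<close> such that this maximum over \<open>x \<le> bound m\<close> eventually exceeds \<open>m\<close>.  The \<open>s\<^sub>1\<close>-function
  starts with the maximum over \<open>x \<le> 0\<close>, and its row \<open>i + 1\<close> is at stage \<open>s\<close> the maximum over all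
  \<open>x \<le> bound m\<close>, where \<open>m\<close> is the value of row \<open>i\<close> at stage \<open>s\<close>.  If \<open>m\<close> grows then the
  maximum is taken over a larger set, so the value never decreases; once row \<open>i\<close> has reached its
  limit the set is fixed, so row \<open>i + 1\<close> converges to a class size above that limit.
\<close>

section \<open>Closure properties of the total recursive functions\<close>

text \<open>
  Programs carry no arity and read their arguments from a list, so functions of all arities are
  treated together as functions on lists whose length is fixed.
\<close>

definition total_recursive :: "nat \<Rightarrow> (nat list \<Rightarrow> nat) \<Rightarrow> bool" where
  "total_recursive k F \<longleftrightarrow> (\<exists>r. \<forall>xs. length xs = k \<longrightarrow> evals r xs (F xs))"

lemma computable1_iff_total_recursive:
  "computable1 g \<longleftrightarrow> total_recursive 1 (\<lambda>xs. g (xs ! 0))"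
  unfolding computable1_def total_recursive_def
  by (rule arg_cong[where f = Ex]) (fastforce simp: length_Suc_conv)

lemma computable2_iff_total_recursive:
  "computable2 f \<longleftrightarrow> total_recursive 2 (\<lambda>xs. f (xs ! 0) (xs ! 1))"
  unfolding computable2_def total_recursive_def
  by (rule arg_cong[where f = Ex]) (fastforce simp: length_Suc_conv numeral_2_eq_2)

lemma total_recursive_cong:
  assumes "total_recursive k F" and "\<And>xs. length xs = k \<Longrightarrow> F xs = G xs"
  shows "total_recursive k G"
  using assms unfolding total_recursive_def by metis

lemma total_recursive_proj: "i < k \<Longrightarrow> total_recursive k (\<lambda>xs. xs ! i)"
  unfolding total_recursive_def by (metis evals_Proj)

lemma total_recursive_comp:
  assumes F: "total_recursive (length Gs) F"
    and Gs: "\<And>G. G \<in> set Gs \<Longrightarrow> total_recursive k G"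
  shows "total_recursive k (\<lambda>xs. F (map (\<lambda>G. G xs) Gs))"
proof -
  obtain f where f: "\<And>xs. length xs = length Gs \<Longrightarrow> evals f xs (F xs)"
    using F unfolding total_recursive_def by blast
  obtain p where p: "\<And>G xs. G \<in> set Gs \<Longrightarrow> length xs = k \<Longrightarrow> evals (p G) xs (G xs)"
    using Gs unfolding total_recursive_def by metis
  have "evals (Comp f (map p Gs)) xs (F (map (\<lambda>G. G xs) Gs))" if "length xs = k" for xs
  proof (rule evals_Comp)
    show "list_all2 (\<lambda>g y. evals g xs y) (map p Gs) (map (\<lambda>G. G xs) Gs)"
      using p that by (simp add: list_all2_conv_all_nth)
    show "evals f (map (\<lambda>G. G xs) Gs) (F (map (\<lambda>G. G xs) Gs))"
      by (rule f) simp
  qed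
  then show ?thesis unfolding total_recursive_def by blast
qed

lemma total_recursive_comp1:
  assumes "computable1 g" "total_recursive k G"
  shows "total_recursive k (\<lambda>xs. g (G xs))"
  using total_recursive_comp[of "[G]" "\<lambda>xs. g (xs ! 0)" k] assms
  by (simp add: computable1_iff_total_recursive)

lemma total_recursive_comp2:
  assumes "computable2 f" "total_recursive k G" "total_recursive k H"
  shows "total_recursive k (\<lambda>xs. f (G xs) (H xs))"
proof -
  have "total_recursive (length [G, H]) (\<lambda>xs. f (xs ! 0) (xs ! 1))"
    using assms(1) by (simp add: computable2_iff_total_recursive numeral_2_eq_2)
  then have "total_recursive k
      (\<lambda>xs. f (map (\<lambda>G. G xs) [G, H] ! 0) (map (\<lambda>G. G xs) [G, H] ! 1))"
    by (rule total_recursive_comp) (use assms in auto)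
  then show ?thesis by simp
qed

lemma computable1_Suc: "computable1 Suc"
  unfolding computable1_def by (blast intro: evals_Succ)

lemma total_recursive_const: "total_recursive k (\<lambda>xs. n)"
proof (induction n)
  case 0
  show ?case unfolding total_recursive_def by (blast intro: evals_Zero)
next
  case (Suc n)
  then show ?case by (rule total_recursive_comp1[OF computable1_Suc])
qed

text \<open>
  The program format only allows recursion over the first argument with the remaining arguments
  as parameters; composition with projections frees the recursion depth from being an argument.
\<close>

lemma total_recursive_rec_nat:
  assumes N: "total_recursive k N" and F: "total_recursive k F"
    and G: "total_recursive (Suc (Suc k)) G"
  shows "total_recursive k (\<lambda>xs. rec_nat (F xs) (\<lambda>n y. G (n # y # xs)) (N xs))"
proof -
  obtain f where f: "\<And>xs. length xs = k \<Longrightarrow> evals f xs (F xs)"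
    using F unfolding total_recursive_def by blast
  obtain g where g: "\<And>xs. length xs = Suc (Suc k) \<Longrightarrow> evals g xs (G xs)"
    using G unfolding total_recursive_def by blast
  have rec: "evals (PrimRec f g) (n # xs) (rec_nat (F xs) (\<lambda>n y. G (n # y # xs)) n)"
    if "length xs = k" for n xs
  proof (induction n)
    case 0
    show ?case using f[OF that] by (auto intro: evals_PrimRec_0)
  next
    case (Suc n)
    then show ?case using g that by (auto intro: evals_PrimRec_Suc)
  qed
  let ?R = "\<lambda>xs. rec_nat (F (tl xs)) (\<lambda>n y. G (n # y # tl xs)) (hd xs)"
  let ?Ps = "N # map (\<lambda>i xs. xs ! i) [0..<k]"
  have "total_recursive (length ?Ps) ?R"
    unfolding total_recursive_def
    by (rule exI[of _ "PrimRec f g"]) (auto simp: length_Suc_conv rec)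
  then have "total_recursive k (\<lambda>xs. ?R (map (\<lambda>G. G xs) ?Ps))"
    by (rule total_recursive_comp) (use N total_recursive_proj in auto)
  then show ?thesis
  proof (rule total_recursive_cong)
    fix xs :: "nat list" assume "length xs = k"
    then have "map (\<lambda>G. G xs) ?Ps = N xs # xs"
      using map_nth[of xs] by (simp add: comp_def)
    then show "?R (map (\<lambda>G. G xs) ?Ps) = rec_nat (F xs) (\<lambda>n y. G (n # y # xs)) (N xs)"
      by simp
  qed
qed

lemma total_recursive_Least:
  assumes F: "total_recursive (Suc k) F"
    and ex: "\<And>xs. length xs = k \<Longrightarrow> \<exists>n. F (n # xs) = 0"
  shows "total_recursive k (\<lambda>xs. LEAST n. F (n # xs) = 0)"
proof -
  obtain f where f: "\<And>xs. length xs = Suc k \<Longrightarrow> evals f xs (F xs)"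
    using F unfolding total_recursive_def by blast
  have "evals (Mu f) xs (LEAST n. F (n # xs) = 0)" if xs: "length xs = k" for xs
  proof (rule evals_Mu)
    have "F ((LEAST n. F (n # xs) = 0) # xs) = 0"
      using ex[OF xs] by (rule LeastI_ex)
    then show "evals f ((LEAST n. F (n # xs) = 0) # xs) 0"
      using f[of "(LEAST n. F (n # xs) = 0) # xs"] xs by simp
    show "\<forall>m<LEAST n. F (n # xs) = 0. \<exists>y. evals f (m # xs) (Suc y)"
    proof (intro allI impI)
      fix m assume "m < (LEAST n. F (n # xs) = 0)"
      then have "F (m # xs) \<noteq> 0" by (rule not_less_Least)
      then obtain y where "F (m # xs) = Suc y" using not0_implies_Suc by blast
      then show "\<exists>y. evals f (m # xs) (Suc y)"
        using f[of "m # xs"] xs by auto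
    qed
  qed
  then show ?thesis unfolding total_recursive_def by blast
qed


section \<open>Arithmetic, bounded sums and bounded maxima\<close>

lemma computable2_add: "computable2 (+)"
proof -
  have "total_recursive 2 (\<lambda>xs. rec_nat (xs ! 0) (\<lambda>n y. Suc ((n # y # xs) ! 1)) (xs ! 1))"
    by (intro total_recursive_rec_nat total_recursive_comp1[OF computable1_Suc]
        total_recursive_proj) auto
  moreover have "rec_nat a (\<lambda>n y. Suc y) b = a + b" for a b :: nat
    by (induction b) auto
  ultimately show ?thesis by (simp add: computable2_iff_total_recursive)
qed

lemma computable2_diff: "computable2 (-)"
proof -
  have "total_recursive 1 (\<lambda>xs. rec_nat 0 (\<lambda>n y. (n # y # xs) ! 0) (xs ! 0))"
    by (intro total_recursive_rec_nat total_recursive_const total_recursive_proj) auto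
  moreover have "rec_nat 0 (\<lambda>n y. n) a = a - 1" for a :: nat
    by (cases a) auto
  ultimately have pred: "computable1 (\<lambda>a. a - 1)"
    by (simp add: computable1_iff_total_recursive)
  have "total_recursive 2 (\<lambda>xs. rec_nat (xs ! 0) (\<lambda>n y. (n # y # xs) ! 1 - 1) (xs ! 1))"
    by (intro total_recursive_rec_nat total_recursive_comp1[OF pred] total_recursive_proj) auto
  moreover have "rec_nat a (\<lambda>n y. y - 1) b = a - b" for a b :: nat
    by (induction b) auto
  ultimately show ?thesis by (simp add: computable2_iff_total_recursive)
qed

lemma total_recursive_add:
  "total_recursive k G \<Longrightarrow> total_recursive k H \<Longrightarrow> total_recursive k (\<lambda>xs. G xs + H xs)"
  by (rule total_recursive_comp2[OF computable2_add])

lemma total_recursive_diff: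
  "total_recursive k G \<Longrightarrow> total_recursive k H \<Longrightarrow> total_recursive k (\<lambda>xs. G xs - H xs)"
  by (rule total_recursive_comp2[OF computable2_diff])

lemma total_recursive_max:
  assumes "total_recursive k G" "total_recursive k H"
  shows "total_recursive k (\<lambda>xs. max (G xs) (H xs))"
proof -
  have "total_recursive k (\<lambda>xs. G xs + (H xs - G xs))"
    by (intro total_recursive_add total_recursive_diff assms)
  moreover have "a + (b - a) = max a b" for a b :: nat by simp
  ultimately show ?thesis by simp
qed

lemma total_recursive_of_bool_eq:
  assumes "total_recursive k G" "total_recursive k H"
  shows "total_recursive k (\<lambda>xs. of_bool (G xs = H xs))"
proof -
  have "total_recursive k (\<lambda>xs. 1 - ((G xs - H xs) + (H xs - G xs)))"
    by (intro total_recursive_add total_recursive_diff total_recursive_const assms)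
  then show ?thesis by (rule total_recursive_cong) auto
qed

text \<open>
  The step function of a recursion receives the accumulated value at position \<open>1\<close>.  This adapts
  a function of the counter and the parameters alone, such as the summand of a bounded sum, to
  that format.
\<close>

lemma total_recursive_skip_second:
  assumes "total_recursive (Suc k) G"
  shows "total_recursive (Suc (Suc k)) (\<lambda>ys. G (hd ys # drop 2 ys))"
proof -
  let ?Ps = "(\<lambda>ys. ys ! 0) # map (\<lambda>i ys. ys ! (i + 2)) [0..<k]"
  have "total_recursive (Suc (Suc k)) (\<lambda>ys. G (map (\<lambda>P. P ys) ?Ps))"
    using assms by (intro total_recursive_comp) (auto intro: total_recursive_proj)
  then show ?thesis
  proof (rule total_recursive_cong)
    fix ys :: "nat list" assume len: "length ys = Suc (Suc k)"
    have "map (\<lambda>i. ys ! (i + 2)) [0..<k] = drop 2 ys"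
      using len by (intro nth_equalityI) (auto simp: add.commute)
    moreover have "ys ! 0 = hd ys" using len by (cases ys) auto
    ultimately show "G (map (\<lambda>P. P ys) ?Ps) = G (hd ys # drop 2 ys)"
      by (simp add: comp_def)
  qed
qed

lemma total_recursive_sum:
  assumes N: "total_recursive k N" and G: "total_recursive (Suc k) G"
  shows "total_recursive k (\<lambda>xs. \<Sum>i<N xs. G (i # xs))"
proof -
  have "total_recursive k (\<lambda>xs. rec_nat 0 (\<lambda>n y. (\<lambda>ys. ys ! 1 + G (hd ys # drop 2 ys))
      (n # y # xs)) (N xs))"
    by (intro total_recursive_rec_nat total_recursive_add total_recursive_skip_second
        total_recursive_const total_recursive_proj N G) auto
  moreover have "rec_nat 0 (\<lambda>n y. y + g n) m = (\<Sum>i<m. g i)" for g :: "nat \<Rightarrow> nat" and m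
    by (induction m) auto
  ultimately show ?thesis by simp
qed

lemma total_recursive_of_bool_ex:
  assumes N: "total_recursive k N" and P: "total_recursive (Suc k) (\<lambda>xs. of_bool (P xs))"
  shows "total_recursive k (\<lambda>xs. of_bool (\<exists>i<N xs. P (i # xs)))"
proof -
  have "total_recursive k (\<lambda>xs. 1 - (1 - (\<Sum>i<N xs. of_bool (P (i # xs)))))"
    by (intro total_recursive_diff total_recursive_const total_recursive_sum[OF N P])
  moreover have "1 - (1 - (\<Sum>i<m. of_bool (Q i))) = (of_bool (\<exists>i<m. Q i) :: nat)"
    for Q :: "nat \<Rightarrow> bool" and m
    by (induction m) (auto simp: less_Suc_eq simp del: sum_of_bool_eq)
  ultimately show ?thesis by simp
qed

lemma total_recursive_of_bool_conj:
  assumes "total_recursive k (\<lambda>xs. of_bool (P xs))" "total_recursive k (\<lambda>xs. of_bool (Q xs))"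
  shows "total_recursive k (\<lambda>xs. of_bool (P xs \<and> Q xs))"
proof -
  have "total_recursive k (\<lambda>xs. (of_bool (P xs) + of_bool (Q xs)) - 1)"
    by (intro total_recursive_diff total_recursive_add total_recursive_const assms)
  then show ?thesis by (rule total_recursive_cong) auto
qed

lemma computable2_bounded_Max:
  assumes c: "computable2 c"
  shows "computable2 (\<lambda>b s. Max ((\<lambda>x. c x s) ` {..b}))"
proof -
  have "total_recursive 2 (\<lambda>xs. rec_nat (c 0 (xs ! 1))
      (\<lambda>n y. (\<lambda>ys. max (ys ! 1) (c (Suc (ys ! 0)) (ys ! 3))) (n # y # xs)) (xs ! 0))"
    by (intro total_recursive_rec_nat total_recursive_max total_recursive_comp2[OF c]
        total_recursive_comp1[OF computable1_Suc] total_recursive_const total_recursive_proj) auto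
  moreover have "rec_nat (c 0 s) (\<lambda>n y. max y (c (Suc n) s)) b = Max ((\<lambda>x. c x s) ` {..b})"
    for s b
    by (induction b) (auto simp: atMost_Suc max.commute)
  ultimately show ?thesis by (simp add: computable2_iff_total_recursive)
qed


section \<open>Increasing limits of sizes approximated from below\<close>

locale sizes_from_below =
  fixes c :: "nat \<Rightarrow> nat \<Rightarrow> nat" and size :: "nat \<Rightarrow> nat"
  assumes computable: "computable2 c"
    and mono_stage: "\<And>x s t. s \<le> t \<Longrightarrow> c x s \<le> c x t"
    and reaches_size: "\<And>x. eventually (\<lambda>s. c x s = size x) sequentially"
    and unbounded: "\<And>m. \<exists>x. m < size x"
begin

definition max_upto :: "nat \<Rightarrow> nat \<Rightarrow> nat" where
  "max_upto b s = Max ((\<lambda>x. c x s) ` {..b})"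

text \<open>
  Using one number both as index bound and as stage makes this a search over a single
  variable; nothing is lost because the maximum is monotone in both arguments.
\<close>

definition bound :: "nat \<Rightarrow> nat" where
  "bound m = (LEAST t. m < max_upto t t)"

definition row :: "nat \<Rightarrow> nat \<Rightarrow> nat" where
  "row i s = rec_nat (max_upto 0 s) (\<lambda>_ m. max_upto (bound m) s) i"

lemma row_0: "row 0 s = max_upto 0 s"
  and row_Suc: "row (Suc i) s = max_upto (bound (row i s)) s"
  by (simp_all add: row_def)

lemma le_max_upto: "x \<le> b \<Longrightarrow> c x s \<le> max_upto b s"
  unfolding max_upto_def by (rule Max_ge) auto

lemma max_upto_mono:
  assumes "b \<le> b'" "s \<le> t"
  shows "max_upto b s \<le> max_upto b' t"
  unfolding max_upto_def
proof (rule Max.boundedI)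
  fix v assume "v \<in> (\<lambda>x. c x s) ` {..b}"
  then obtain x where "x \<le> b" "v = c x s" by auto
  then show "v \<le> Max ((\<lambda>x. c x t) ` {..b'})"
    using mono_stage[OF assms(2), of x] le_max_upto[of x b' t] assms(1)
    unfolding max_upto_def by linarith
qed auto

text \<open>Finitely many approximations have all reached their limits from some stage on.\<close>

lemma eventually_max_upto:
  "eventually (\<lambda>s. max_upto b s = Max (size ` {..b})) sequentially"
proof -
  have "eventually (\<lambda>s. \<forall>x\<in>{..b}. c x s = size x) sequentially"
    using reaches_size by (simp add: eventually_ball_finite)
  then show ?thesis
    by (rule eventually_mono) (auto simp: max_upto_def intro!: arg_cong[where f = Max])
qed

lemma max_upto_unbounded: "\<exists>t. m < max_upto t t"
proof -
  obtain x where x: "m < size x" using unbounded by blast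
  obtain s where "\<And>t. t \<ge> s \<Longrightarrow> c x t = size x"
    using reaches_size[of x] unfolding eventually_sequentially by blast
  then have "m < c x (max x s)" using x by simp
  also have "\<dots> \<le> max_upto (max x s) (max x s)" by (rule le_max_upto) simp
  finally show ?thesis by blast
qed

lemma less_max_upto_bound: "m < max_upto (bound m) (bound m)"
  unfolding bound_def by (rule LeastI_ex) (rule max_upto_unbounded)

lemma bound_mono: "m \<le> m' \<Longrightarrow> bound m \<le> bound m'"
  using less_max_upto_bound[of m'] unfolding bound_def[of m] by (intro Least_le) simp

lemma less_Max_size_bound: "m < Max (size ` {..bound m})"
proof -
  obtain s where "\<And>t. t \<ge> s \<Longrightarrow> max_upto (bound m) t = Max (size ` {..bound m})"
    using eventually_max_upto[of "bound m"] unfolding eventually_sequentially by blast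
  then have "max_upto (bound m) (max s (bound m)) = Max (size ` {..bound m})" by simp
  moreover have "max_upto (bound m) (bound m) \<le> max_upto (bound m) (max s (bound m))"
    by (rule max_upto_mono) auto
  ultimately show ?thesis using less_max_upto_bound[of m] by simp
qed

lemma computable2_max_upto: "computable2 max_upto"
  using computable2_bounded_Max[OF computable] unfolding max_upto_def[abs_def] .

lemma computable1_bound: "computable1 bound"
proof -
  \<comment> \<open>Minimisation looks for a zero: \<open>m < v\<close> is the vanishing of \<open>Suc m - v\<close>.\<close>
  have "total_recursive 1
      (\<lambda>xs. LEAST t. (\<lambda>ys. Suc (ys ! 1) - max_upto (ys ! 0) (ys ! 0)) (t # xs) = 0)"
  proof (rule total_recursive_Least)
    show "total_recursive (Suc 1) (\<lambda>ys. Suc (ys ! 1) - max_upto (ys ! 0) (ys ! 0))"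
      by (intro total_recursive_diff total_recursive_comp1[OF computable1_Suc]
          total_recursive_comp2[OF computable2_max_upto] total_recursive_proj) auto
  next
    fix xs :: "nat list"
    show "\<exists>t. Suc ((t # xs) ! 1) - max_upto ((t # xs) ! 0) ((t # xs) ! 0) = 0"
      using max_upto_unbounded[of "xs ! 0"] by (auto simp: Suc_le_eq)
  qed
  then show ?thesis
    by (simp add: computable1_iff_total_recursive bound_def Suc_le_eq)
qed

lemma computable2_row: "computable2 row"
proof -
  have "total_recursive 2 (\<lambda>xs. rec_nat (max_upto 0 (xs ! 1))
      (\<lambda>n y. (\<lambda>ys. max_upto (bound (ys ! 1)) (ys ! 3)) (n # y # xs)) (xs ! 0))"
    by (intro total_recursive_rec_nat total_recursive_comp2[OF computable2_max_upto]
        total_recursive_comp1[OF computable1_bound] total_recursive_const total_recursive_proj)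
      auto
  then show ?thesis by (simp add: computable2_iff_total_recursive row_def)
qed

lemma row_mono_stage: "s \<le> t \<Longrightarrow> row i s \<le> row i t"
  by (induction i) (auto simp: row_0 row_Suc intro: max_upto_mono bound_mono)

fun limit_row :: "nat \<Rightarrow> nat" where
  "limit_row 0 = Max (size ` {..0})"
| "limit_row (Suc i) = Max (size ` {..bound (limit_row i)})"

lemma eventually_row: "eventually (\<lambda>s. row i s = limit_row i) sequentially"
proof (induction i)
  case 0
  show ?case using eventually_max_upto[of 0] by (simp add: row_0)
next
  case (Suc i)
  show ?case using Suc eventually_max_upto[of "bound (limit_row i)"]
    by eventually_elim (simp add: row_Suc)
qed

lemma row_tendsto: "row i \<longlonglongrightarrow> limit_row i"
  using eventually_row[of i] by (rule tendsto_eventually)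

lemma lim_row: "lim (row i) = limit_row i"
  using row_tendsto by (rule limI)

lemma limit_row_is_size: "\<exists>x. limit_row i = size x"
proof -
  have "\<exists>x. Max (size ` {..b}) = size x" for b
  proof -
    have "Max (size ` {..b}) \<in> size ` {..b}" by (rule Max_in) auto
    then show ?thesis by blast
  qed
  then show ?thesis by (cases i) (simp_all del: atMost_0)
qed

lemma s1_function_row: "s1_function row"
  unfolding s1_function_def
proof (intro conjI allI)
  fix i s
  show "row i s \<le> row i (Suc s)" by (rule row_mono_stage) simp
  show "convergent (row i)" using row_tendsto by (rule convergentI)
  show "lim (row i) < lim (row (Suc i))" by (simp add: lim_row less_Max_size_bound)
qed

lemma exists_s1_function:
  "\<exists>f. computable2 f \<and> s1_function f \<and> (\<forall>i. \<exists>x. lim (f i) = size x)"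
  using computable2_row s1_function_row limit_row_is_size by (metis lim_row)

end


section \<open>Approximating class sizes from an enumeration\<close>

definition seen :: "(nat \<Rightarrow> nat) \<Rightarrow> (nat \<Rightarrow> nat) \<Rightarrow> nat \<Rightarrow> nat \<Rightarrow> nat set" where
  "seen g h x s = {y. y < s \<and> (\<exists>n<s. g n = x \<and> h n = y)}"

lemma finite_seen: "finite (seen g h x s)"
  unfolding seen_def by simp

lemma seen_mono: "s \<le> t \<Longrightarrow> seen g h x s \<subseteq> seen g h x t"
  unfolding seen_def by (auto dest: less_le_trans)

lemma computable2_card_seen:
  assumes g: "computable1 g" and h: "computable1 h"
  shows "computable2 (\<lambda>x s. card (seen g h x s))"
proof -
  \<comment> \<open>The argument lists are \<open>[n, y, x, s]\<close>, \<open>[y, x, s]\<close> and \<open>[x, s]\<close>.\<close>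
  have "total_recursive 4 (\<lambda>zs. of_bool (g (zs ! 0) = zs ! 2 \<and> h (zs ! 0) = zs ! 1))"
    by (intro total_recursive_of_bool_conj total_recursive_of_bool_eq total_recursive_proj
        total_recursive_comp1[OF g] total_recursive_comp1[OF h]) auto
  then have "total_recursive 3 (\<lambda>ys. of_bool (\<exists>n<ys ! 2.
      (\<lambda>zs. g (zs ! 0) = zs ! 2 \<and> h (zs ! 0) = zs ! 1) (n # ys)))"
    by (intro total_recursive_of_bool_ex total_recursive_proj) auto
  then have "total_recursive 2 (\<lambda>xs. \<Sum>y<xs ! 1. (\<lambda>ys. of_bool (\<exists>n<ys ! 2.
      (\<lambda>zs. g (zs ! 0) = zs ! 2 \<and> h (zs ! 0) = zs ! 1) (n # ys))) (y # xs))"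
    by (intro total_recursive_sum total_recursive_proj) (auto simp: numeral_3_eq_3)
  moreover have "(\<Sum>y<s. of_bool (\<exists>n<s. g n = x \<and> h n = y)) = card (seen g h x s)" for x s
    by (simp add: seen_def sum.If_cases of_bool_def Int_def lessThan_def)
  ultimately show ?thesis
    by (simp add: computable2_iff_total_recursive)
qed

text \<open>
  Each member \<open>y\<close> of the finite set on the right is seen as soon as the stage exceeds both \<open>y\<close> and
  one index at which \<open>(x, y)\<close> is enumerated.
\<close>

lemma eventually_seen:
  assumes E: "E = range (\<lambda>n. (g n, h n))" and fin: "finite (E `` {x})"
  shows "eventually (\<lambda>s. seen g h x s = E `` {x}) sequentially"
proof -
  have "eventually (\<lambda>s. y \<in> seen g h x s) sequentially" if y: "y \<in> E `` {x}" for y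
  proof -
    obtain n where n: "g n = x" "h n = y" using y unfolding E by blast
    have "eventually (\<lambda>s. max n y < s) sequentially" by (rule eventually_gt_at_top)
    then show ?thesis by (rule eventually_mono) (use n in \<open>auto simp: seen_def\<close>)
  qed
  then have "eventually (\<lambda>s. \<forall>y\<in>E `` {x}. y \<in> seen g h x s) sequentially"
    using fin by (simp add: eventually_ball_finite)
  moreover have "seen g h x s \<subseteq> E `` {x}" for s
    unfolding seen_def E by auto
  ultimately show ?thesis by (auto elim!: eventually_mono)
qed

theorem lemma1p9:
  fixes E :: "(nat \<times> nat) set"
  assumes "ce_equivalence_structure E"
    and "\<forall>C \<in> UNIV // E. finite C"
    and "unbounded_character E"
  shows "\<exists>f :: nat \<Rightarrow> nat \<Rightarrow> nat.
    computable2 f \<and> s1_function f \<and> (\<forall>i. has_class_of_size E (lim (\<lambda>s. f i s)))"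
proof -
  have eq: "equiv UNIV E" and ce: "comp_enum_rel E"
    using assms(1) unfolding ce_equivalence_structure_def by auto
  have "(0, 0) \<in> E" using eq by (auto simp: equiv_def refl_on_def)
  then obtain g h where g: "computable1 g" and h: "computable1 h"
    and E: "E = range (\<lambda>n. (g n, h n))"
    using ce unfolding comp_enum_rel_def by auto
  have fin: "finite (E `` {x})" for x
    using assms(2) by (simp add: quotientI)
  interpret sizes_from_below "\<lambda>x s. card (seen g h x s)" "\<lambda>x. card (E `` {x})"
  proof
    show "computable2 (\<lambda>x s. card (seen g h x s))"
      using g h by (rule computable2_card_seen)
  next
    fix x s t :: nat assume "s \<le> t"
    then show "card (seen g h x s) \<le> card (seen g h x t)"
      by (intro card_mono finite_seen seen_mono)
  next
    fix x
    show "eventually (\<lambda>s. card (seen g h x s) = card (E `` {x})) sequentially"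
      using eventually_seen[OF E fin[of x]] by (rule eventually_mono) simp
  next
    fix m
    obtain k where "m < k" and "has_class_of_size E k"
      using assms(3) unfolding unbounded_character_def by (meson Suc_le_lessD)
    then show "\<exists>x. m < card (E `` {x})"
      unfolding has_class_of_size_def by (auto elim: quotientE)
  qed
  have "has_class_of_size E (card (E `` {x}))" for x
    unfolding has_class_of_size_def using fin by (blast intro: quotientI)
  then show ?thesis using exists_s1_function by metis
qed

end
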